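(* Let $(a_n)_{n\ge1}$ be a periodic E-sequence, i.e. there are integers $l\ge0$, $r\ge1$ with $a_n=a_{n+r}$ for all $n>l$. If $(a_n)$ is $\Omega$-convergent to the odd positive integer $x$, then the trajectory $(x_n)_{n\ge0}$ of $x$ is periodic, i.e. there exist integers $l'\ge0$, $r'\ge1$ with $x_n=x_{n+r'}$ for all $n>l'$.
   Context: An E-sequence is any infinite sequence $(a_n)_{n\ge1}$ of positive integers. For an odd positive integer $x$, its trajectory $(x_n)_{n\ge0}$ and its E-sequence $(a_n)_{n\ge1}$ are defined by $x_0=x$ and, for $n\ge1$, $x_n=\frac{3x_{n-1}+1}{2^{a_n}}$, where $a_n$ is the exponent of the largest power of $2$ dividing $3x_{n-1}+1$. An E-sequence is $\Omega$-convergent to $x$ if it is the E-sequence of $x$. *)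

theory Defs
  imports "HOL-Computational_Algebra.Primes" Complex_Main
begin

text \<open>
  An E-sequence \<open>(a\<^sub>n)\<close>, \<open>n \<ge> 1\<close>, is a function on \<^typ>\<open>nat\<close> whose value at \<open>0\<close> is irrelevant.
\<close>

definition E_sequence :: "(nat \<Rightarrow> nat) \<Rightarrow> bool" where
  "E_sequence a \<longleftrightarrow> (\<forall>n\<ge>1. 0 < a n)"

text \<open>The natural-number division is exact, see \<open>trajectory_step\<close> below.\<close>

fun trajectory :: "nat \<Rightarrow> nat \<Rightarrow> nat" where
  "trajectory x 0 = x"
| "trajectory x (Suc n) =
     (3 * trajectory x n + 1) div 2 ^ multiplicity 2 (3 * trajectory x n + 1)"

definition E_sequence_of :: "nat \<Rightarrow> nat \<Rightarrow> nat" where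
  "E_sequence_of x n = multiplicity 2 (3 * trajectory x (n - 1) + 1)"

definition Omega_convergent :: "(nat \<Rightarrow> nat) \<Rightarrow> nat \<Rightarrow> bool" where
  "Omega_convergent a x \<longleftrightarrow> 0 < x \<and> odd x \<and> (\<forall>n\<ge>1. a n = E_sequence_of x n)"

text \<open>Periodicity allows a preperiod, for E-sequences and trajectories alike.\<close>

definition periodic_seq :: "(nat \<Rightarrow> nat) \<Rightarrow> bool" where
  "periodic_seq s \<longleftrightarrow> (\<exists>l r. 1 \<le> r \<and> (\<forall>n>l. s n = s (n + r)))"

lemma trajectory_step:
  assumes "1 \<le> n"
  shows "real (trajectory x n) = (3 * real (trajectory x (n - 1)) + 1) / 2 ^ E_sequence_of x n"
proof -
  obtain m where n: "n = Suc m" using assms by (cases n) auto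
  have "2 ^ multiplicity 2 (3 * trajectory x m + 1) dvd 3 * trajectory x m + 1"
    by (rule multiplicity_dvd)
  then have "real ((3 * trajectory x m + 1) div 2 ^ multiplicity 2 (3 * trajectory x m + 1))
      = real (3 * trajectory x m + 1) / real (2 ^ multiplicity 2 (3 * trajectory x m + 1))"
    by (rule real_of_nat_div)
  then show ?thesis by (simp add: n E_sequence_of_def)
qed

lemma odd_trajectory:
  assumes "odd x"
  shows "odd (trajectory x n)"
proof (cases n)
  case 0
  then show ?thesis using assms by simp
next
  case (Suc m)
  have "\<not> 2 dvd (3 * trajectory x m + 1) div 2 ^ multiplicity 2 (3 * trajectory x m + 1)"
    by (rule multiplicity_decompose) auto
  then show ?thesis using Suc by simp
qed

end

theory Submission
  imports Defs
begin

text \<open>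
  If \<open>a\<close> has period \<open>r\<close> from some point on, the differences \<open>d\<^sub>n = x\<^sub>n\<^sub>+\<^sub>r - x\<^sub>n\<close> eventually satisfy
  \<open>2 ^ a\<^sub>n\<^sub>+\<^sub>1 * d\<^sub>n\<^sub>+\<^sub>1 = 3 * d\<^sub>n\<close>. Since every \<open>a\<^sub>n\<close> is positive, each \<open>d\<^sub>n\<close> is divisible by all
  powers of 2, hence zero.
\<close>

lemma trajectory_Suc_mult:
  "2 ^ E_sequence_of x (Suc n) * trajectory x (Suc n) = 3 * trajectory x n + 1"
  by (simp add: E_sequence_of_def multiplicity_dvd del: mult_Suc_right)

lemma eq_zero_if_all_powers_dvd:
  fixes d :: int
  assumes "\<And>k. 2 ^ k dvd d"
  shows "d = 0"
proof (rule ccontr)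
  assume "d \<noteq> 0"
  then have "finite {k. 2 ^ k dvd d}"
    by (intro finite_divisor_powers) auto
  with assms show False by simp
qed

theorem theorem3p5:
  fixes a :: "nat \<Rightarrow> nat" and x :: nat
  assumes "E_sequence a"
    and "periodic_seq a"
    and "Omega_convergent a x"
  shows "periodic_seq (trajectory x)"
proof -
  obtain l r where r: "1 \<le> r" and per: "\<And>n. n > l \<Longrightarrow> a n = a (n + r)"
    using assms(2) unfolding periodic_seq_def by blast
  define d where "d n = int (trajectory x (n + r)) - int (trajectory x n)" for n
  have step: "2 ^ a (Suc n) * int (trajectory x (Suc n)) = 3 * int (trajectory x n) + 1" for n
  proof -
    have "a (Suc n) = E_sequence_of x (Suc n)"
      using assms(3) by (simp add: Omega_convergent_def)
    then have "int (2 ^ a (Suc n) * trajectory x (Suc n)) = int (3 * trajectory x n + 1)"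
      by (simp only: trajectory_Suc_mult)
    then show ?thesis by simp
  qed
  \<comment> \<open>Subtracting the recursions at \<open>n + r\<close> and \<open>n\<close> cancels
    the \<open>+ 1\<close>. Periodicity is applied at \<open>Suc n > l\<close>, so
    \<open>n = l\<close> is allowed.\<close>
  have d_step: "2 ^ a (Suc n) * d (Suc n) = 3 * d n" if "n \<ge> l" for n
    using step[of n] step[of "n + r"] per[of "Suc n"] that
    by (simp add: d_def right_diff_distrib del: trajectory.simps)
  \<comment> \<open>The index \<open>n\<close> must vary in the induction: the extra factor 2 in
    \<open>d n\<close> comes from \<open>a (Suc n) > 0\<close>, the other \<open>k\<close> from
    \<open>d (Suc n)\<close>.\<close>
  have dvd: "2 ^ k dvd d n" if "n \<ge> l" for k n
    using that
  proof (induction k arbitrary: n)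
    case (Suc k)
    have "0 < a (Suc n)"
      using assms(1) by (simp add: E_sequence_def)
    then have "2 dvd (2 :: int) ^ a (Suc n)" by simp
    moreover have "2 ^ k dvd d (Suc n)" using Suc by simp
    ultimately have "2 ^ Suc k dvd 3 * d n"
      using mult_dvd_mono d_step[OF Suc.prems] by (metis power_Suc)
    moreover have "coprime (2 ^ Suc k) (3 :: int)"
      by (intro coprime_power_left_iff[THEN iffD2] disjI1) simp
    ultimately show ?case
      by (simp only: coprime_dvd_mult_right_iff)
  qed simp
  have "d n = 0" if "n \<ge> l" for n
    using dvd[OF that] by (rule eq_zero_if_all_powers_dvd)
  \<comment> \<open>The trajectory inherits both \<open>l\<close> and \<open>r\<close> from
    \<open>a\<close>.\<close>
  then have "\<forall>n>l. trajectory x n = trajectory x (n + r)"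
    by (simp add: d_def)
  with r show ?thesis
    unfolding periodic_seq_def by blast
qed

end
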